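(* Assume that $g_1$ is continuously differentiable with $L_{g_1}$-Lipschitz continuous gradient and that $E=f+g_1-g_2$ is a KL function. Then the sequence $\{x^n\}_n$ generated by Algorithm pABBDCA$_{\mathrm{se}}$ (described in the context) globally converges to a critical point $x^*$ with a finite trajectory length, i.e. $$\sum_{n=0}^{\infty}\|x^{n+1}-x^n\|<\infty.$$
   Context: Setting. $X$ is a finite-dimensional real Hilbert space with inner product $\langle\cdot,\cdot\rangle$ and norm $\|\cdot\|$. $E(x)=f(x)+g_1(x)-g_2(x)$, where $f$ is convex and continuously differentiable with $L$-Lipschitz gradient, and $g_1,g_2$ are proper closed convex functions. For a convex function, $\partial$ is the convex subdifferential. Standing assumptions: $E$ is bounded from below and all level sets $\{x:E(x)\le\alpha\}$, $\alpha\in\mathbb{R}$, are compact. When $g_1$ is differentiable, $\partial E(x):=\nabla f(x)+\nabla g_1(x)-\partial g_2(x)$; $x$ is a critical point if $0\in\partial E(x)$. $\mathrm{dist}(0,S)=\inf_{s\in S}\|s\|$. KL function. A closed proper function $h$ is a KL function if for any critical point $\bar x$ of $h$ there exist $\nu\in(0,+\infty]$, a neighborhood $\mathcal{O}$ of $\bar x$ and a continuous concave function $\psi:[0,\nu)\to[0,+\infty)$ with $\psi(0)=0$ such that $\psi$ is continuously differentiable on $(0,\nu)$ with $\psi'>0$ there, and for every $x\in\mathcal{O}$ with $h(\bar x)<h(x)<h(\bar x)+\nu$ one has $\psi'(h(x)-h(\bar x))\cdot\mathrm{dist}(0,\partial h(x))\ge1$. Algorithm pABBDCA$_{\mathrm{se}}$.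 Inputs: $x^0\in X$, $0<\alpha_{\min}<\alpha_{\max}$, $\alpha_0>0$, initial trial step $\lambda_0=1$, $\rho,\overline\beta,\omega\in(0,1)$, $0<\eta<1/\alpha_{\max}$, $c_0>0$; $x^{-1}=x^0$, $\beta_0=0$, $\lambda_{-1}=1$, $\alpha_{-1}=\alpha_0$. For $n=0,1,2,\dots$: 1. Set $\hat\beta_n=\min\{\frac{n-1}{n+2},\overline\beta\}$; if $n\ge1$ set $\beta_n=\max\{0,\min\{\hat\beta_n,\frac{\alpha_n}{\alpha_{n-1}\lambda_{n-1}}(2-\beta_{n-1})-2c_0\alpha_n\}\}$. 2. Set $y^n=x^n+\beta_n(x^n-x^{n-1})$. Choose $\xi^n\in\partial g_2(x^n)$ and set $u^n=\arg\min_x\{\langle-\xi^n,x-y^n\rangle+\frac{1}{2\alpha_n}\|x-y^n\|^2+f(x)+g_1(x)\}$. 3. Set $d^n=u^n-x^n$, $\nu_n=\frac{\omega}{n+1}\|d^n\|^2$. If $d^n=0$, stop. 4. (Line search) Find the smallest integer $k\ge0$ such that the accepted step $\lambda_n=\lambda_0\rho^k$ (here $\lambda_0=1$ is the initial trial step) satisfies $E(x^n+\lambda_nd^n)\le E(x^n)-\eta\lambda_n\|d^n\|^2+\nu_n$. Set $x^{n+1}=x^n+\lambda_nd^n$, $s^n=x^{n+1}-y^n$, $y_{bb}^n=\nabla f(x^{n+1})-\nabla f(y^n)$. 5. If $\langle s^n,y_{bb}^n\rangle>0$, set $\alpha_{n+1}=\max\{\alpha_{\min},\min\{\alpha_{\max},\tau_n\}\}$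 with $\tau_n=\langle s^n,s^n\rangle/\langle s^n,y_{bb}^n\rangle$ for $n$ even and $\tau_n=\langle s^n,y_{bb}^n\rangle/\langle y_{bb}^n,y_{bb}^n\rangle$ for $n$ odd; otherwise $\alpha_{n+1}=\alpha_{\max}$. The sequences considered are infinite (no stopping rule other than $d^n=0$, and the algorithm does not stop). *)

theory Defs
  imports "HOL-Analysis.Analysis"
begin

text \<open>Extended-real-valued functions are described through their real epigraph.\<close>

definition epi :: "('a \<Rightarrow> ereal) \<Rightarrow> ('a \<times> real) set" where
  "epi h = {(x, t). h x \<le> ereal t}"

definition proper_fun :: "('a \<Rightarrow> ereal) \<Rightarrow> bool" where
  "proper_fun h \<longleftrightarrow> (\<forall>x. h x \<noteq> - \<infinity>) \<and> (\<exists>x. h x \<noteq> \<infinity>)"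

definition closed_fun :: "('a::euclidean_space \<Rightarrow> ereal) \<Rightarrow> bool" where
  "closed_fun h \<longleftrightarrow> closed (epi h)"

definition convex_fun :: "('a::euclidean_space \<Rightarrow> ereal) \<Rightarrow> bool" where
  "convex_fun h \<longleftrightarrow> convex (epi h)"

definition subdiff :: "('a::euclidean_space \<Rightarrow> ereal) \<Rightarrow> 'a \<Rightarrow> 'a set" where
  "subdiff h x = {\<xi>. \<bar>h x\<bar> \<noteq> \<infinity> \<and> (\<forall>z. h x + ereal (\<xi> \<bullet> (z - x)) \<le> h z)}"

text \<open>Extended-real subtraction yields \<open>\<infinity> - \<infinity> = \<infinity>\<close>, the usual convention for
  differences of convex functions.\<close>

definition dc_fun ::
  "('a \<Rightarrow> real) \<Rightarrow> ('a \<Rightarrow> ereal) \<Rightarrow> ('a \<Rightarrow> ereal) \<Rightarrow> 'a \<Rightarrow> ereal" where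
  "dc_fun f g1 g2 x = ereal (f x) + g1 x - g2 x"

text \<open>The subdifferential of \<open>f + g1 - g2\<close> when \<open>f\<close> and \<open>g1\<close> are differentiable with
  gradients \<open>Gf\<close> and \<open>Gg1\<close>.\<close>

definition dc_subdiff ::
  "('a::euclidean_space \<Rightarrow> 'a) \<Rightarrow> ('a \<Rightarrow> 'a) \<Rightarrow> ('a \<Rightarrow> ereal) \<Rightarrow> 'a \<Rightarrow> 'a set" where
  "dc_subdiff Gf Gg1 g2 x = {Gf x + Gg1 x - \<xi> |\<xi>. \<xi> \<in> subdiff g2 x}"

text \<open>The distance from the origin is extended-real-valued so that it is \<open>\<infinity>\<close> for the empty
  set; the library's \<open>infdist\<close> would give \<open>0\<close> there.\<close>

definition dist0 :: "'a::real_normed_vector set \<Rightarrow> ereal" where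
  "dist0 S = (INF s\<in>S. ereal (norm s))"

text \<open>The subdifferential map \<open>dh\<close> of \<open>h\<close> is a parameter.  The value \<open>h x - h xbar\<close> is
  finite wherever it is used, since \<open>h xbar < h x < h xbar + \<nu>\<close>.\<close>

definition KL_function :: "('a::euclidean_space \<Rightarrow> ereal) \<Rightarrow> ('a \<Rightarrow> 'a set) \<Rightarrow> bool" where
  "KL_function h dh \<longleftrightarrow>
     proper_fun h \<and> closed_fun h \<and>
     (\<forall>xbar. 0 \<in> dh xbar \<longrightarrow>
       (\<exists>(\<nu>::ereal) U (\<psi>::real \<Rightarrow> real) \<psi>'.
          0 < \<nu> \<and> open U \<and> xbar \<in> U \<and>
          continuous_on {t. 0 \<le> t \<and> ereal t < \<nu>} \<psi> \<and>
          concave_on {t. 0 \<le> t \<and> ereal t < \<nu>} \<psi> \<and>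
          (\<forall>t. 0 \<le> t \<and> ereal t < \<nu> \<longrightarrow> 0 \<le> \<psi> t) \<and>
          \<psi> 0 = 0 \<and>
          (\<forall>t. 0 < t \<and> ereal t < \<nu> \<longrightarrow> (\<psi> has_real_derivative \<psi>' t) (at t) \<and> 0 < \<psi>' t) \<and>
          continuous_on {t. 0 < t \<and> ereal t < \<nu>} \<psi>' \<and>
          (\<forall>x\<in>U. h xbar < h x \<and> h x < h xbar + \<nu> \<longrightarrow>
             1 \<le> ereal (\<psi>' (real_of_ereal (h x - h xbar))) * dist0 (dh x))))"

definition linesearch_ok ::
  "('a::euclidean_space \<Rightarrow> ereal) \<Rightarrow> real \<Rightarrow> real \<Rightarrow> nat \<Rightarrow> 'a \<Rightarrow> 'a \<Rightarrow> real \<Rightarrow> bool" where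
  "linesearch_ok E \<eta> \<omega> n x d t \<longleftrightarrow>
     E (x + t *\<^sub>R d) \<le>
       E x - ereal (\<eta> * t * (norm d)\<^sup>2) + ereal (\<omega> / (real n + 1) * (norm d)\<^sup>2)"

definition bb_step :: "real \<Rightarrow> real \<Rightarrow> nat \<Rightarrow> 'a::euclidean_space \<Rightarrow> 'a \<Rightarrow> real" where
  "bb_step \<alpha>min \<alpha>max n s w =
     (if 0 < s \<bullet> w
      then max \<alpha>min (min \<alpha>max (if even n then (s \<bullet> s) / (s \<bullet> w) else (s \<bullet> w) / (w \<bullet> w)))
      else \<alpha>max)"

text \<open>
  \<open>pABBDCA_se\<close> says that the sequences form an infinite run of the algorithm: \<open>d\<^sup>n \<noteq> 0\<close> for
  every \<open>n\<close>, so the stopping test is never met.  The parameters are the data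
  \<open>f, Gf, g1, g2\<close>, the inputs \<open>\<alpha>min, \<alpha>max, \<rho>, \<beta>bar, \<omega>, \<eta>, c0\<close>, and the sequences
  \<open>x, y, \<xi>, u\<close> (points), \<open>\<alpha>, \<beta>, l\<close> (step parameter, extrapolation weight, accepted step).
  The input \<open>\<alpha>\<^sub>0\<close> is \<open>\<alpha> 0\<close> and \<open>x\<^sup>0\<close> is \<open>x 0\<close>.  The convention \<open>x\<^sup>-\<^sup>1 = x\<^sup>0\<close> is the truncated
  subtraction in \<open>x (n - 1)\<close> at \<open>n = 0\<close>; the values of \<open>l\<close> and \<open>\<alpha>\<close> at index \<open>-1\<close> are never read,
  because \<open>\<beta> 0 = 0\<close> is prescribed.  The initial trial step of the line search is \<open>1\<close>,
  whereas \<open>l 0\<close> is the step accepted in iteration \<open>0\<close>.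
\<close>

definition pABBDCA_se ::
  "('a::euclidean_space \<Rightarrow> real) \<Rightarrow> ('a \<Rightarrow> 'a) \<Rightarrow> ('a \<Rightarrow> ereal) \<Rightarrow> ('a \<Rightarrow> ereal) \<Rightarrow>
   real \<Rightarrow> real \<Rightarrow> real \<Rightarrow> real \<Rightarrow> real \<Rightarrow> real \<Rightarrow> real \<Rightarrow>
   (nat \<Rightarrow> 'a) \<Rightarrow> (nat \<Rightarrow> 'a) \<Rightarrow> (nat \<Rightarrow> 'a) \<Rightarrow> (nat \<Rightarrow> 'a) \<Rightarrow>
   (nat \<Rightarrow> real) \<Rightarrow> (nat \<Rightarrow> real) \<Rightarrow> (nat \<Rightarrow> real) \<Rightarrow> bool" where
  "pABBDCA_se f Gf g1 g2 \<alpha>min \<alpha>max \<rho> \<beta>bar \<omega> \<eta> c0 x y \<xi> u \<alpha> \<beta> l \<longleftrightarrow>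
     0 < \<alpha>min \<and> \<alpha>min < \<alpha>max \<and> 0 < \<alpha> 0 \<and>
     0 < \<rho> \<and> \<rho> < 1 \<and> 0 < \<beta>bar \<and> \<beta>bar < 1 \<and> 0 < \<omega> \<and> \<omega> < 1 \<and>
     0 < \<eta> \<and> \<eta> < 1 / \<alpha>max \<and> 0 < c0 \<and>
     \<beta> 0 = 0 \<and>
     (\<forall>n\<ge>1. \<beta> n =
        max 0 (min (min ((real n - 1) / (real n + 2)) \<beta>bar)
                   (\<alpha> n / (\<alpha> (n - 1) * l (n - 1)) * (2 - \<beta> (n - 1)) - 2 * c0 * \<alpha> n))) \<and>
     (\<forall>n.
        y n = x n + \<beta> n *\<^sub>R (x n - x (n - 1)) \<and>
        \<xi> n \<in> subdiff g2 (x n) \<and>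
        is_arg_min
          (\<lambda>z. ereal (- \<xi> n \<bullet> (z - y n) + 1 / (2 * \<alpha> n) * (norm (z - y n))\<^sup>2 + f z) + g1 z)
          (\<lambda>z. True) (u n) \<and>
        u n - x n \<noteq> 0 \<and>
        (\<exists>k::nat. l n = \<rho> ^ k \<and>
           linesearch_ok (dc_fun f g1 g2) \<eta> \<omega> n (x n) (u n - x n) (\<rho> ^ k) \<and>
           (\<forall>j<k. \<not> linesearch_ok (dc_fun f g1 g2) \<eta> \<omega> n (x n) (u n - x n) (\<rho> ^ j))) \<and>
        x (Suc n) = x n + l n *\<^sub>R (u n - x n) \<and>
        \<alpha> (Suc n) = bb_step \<alpha>min \<alpha>max n (x (Suc n) - y n) (Gf (x (Suc n)) - Gf (y n)))"

end

theory Submission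
  imports Defs
begin

text \<open>
  Write $p = f + g_1$, $d^n = u^n - x^n$, $\Delta_n = x^n - x^{n-1}$ and
  $e_n = \|\Delta_{n+1}\| = \lambda_n \|d^n\|$.  Since \<open>E\<close> is bounded below and $g_1$ is finite,
  $g_2$ is finite as well, so everything happens with real-valued functions.

  The energy of an iterate alone need not decrease, because the extrapolation contributes a term
  $\frac{\beta_n}{\alpha_n}\langle\Delta_{n+1},\Delta_n\rangle$.  Splitting this term by Young's
  inequality shows that the Lyapunov function
  $H_n = E(x^n) + \frac{\beta_n}{2\alpha_n}\|\Delta_n\|^2$ satisfies
  $H_{n+1} + c_1 e_n^2 \le H_n$ (\<open>H_decrease\<close>): the upper bound that the algorithm puts on
  $\beta_{n+1}$ is exactly what leaves a positive margin $c_1$.  So $e_n \to 0$, and $H_n$ and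
  $E(x^n)$ have the same limit.

  The accepted steps may be arbitrarily small, so $\|d^n\|$ is not directly comparable to $e_n$.
  However, if the unit step is rejected, then the extrapolation term must outweigh the guaranteed
  decrease, and this forces $\|d^n\| \le K e_{n-1}$; if it is accepted, $\|d^n\| = e_n$.  In both
  cases the residual $\nabla p(x^n) - \xi^n \in \partial E(x^n)$ has norm at most
  $C (e_n + e_{n-1})$ (\<open>residual_bound\<close>).  Hence cluster points are critical.

  The Kurdyka-Lojasiewicz inequality is available for \<open>E\<close> but the decreasing quantity is \<open>H\<close>.
  Since $\psi'$ is nonincreasing, the inequality at $E(x^n)$ does not give one at the larger value
  $H_n$ with the same $\psi$.  With $\varphi(t) = 2\psi(t/2) + k\sqrt t$ it does
  (\<open>desingularised_decrease\<close>): if the energy gap dominates the quadratic term, the gap of $H_n$ is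
  at most twice the gap of $E(x^n)$ and the first summand works; otherwise the gap of $H_n$ is of
  order $e_{n-1}^2$, and the square root works.  The resulting recursion
  $e_n^2 \le K (e_n + e_{n-1}) (\varphi(h_n) - \varphi(h_{n+1}))$, where $h_n$ is the gap of $H_n$,
  telescopes and keeps the iterates near one cluster point
  (\<open>local_telescoping_finite_length\<close>).
\<close>

section \<open>Convex functions and tangents\<close>

lemma convex_on_real_of_ereal:
  fixes h :: "'a::euclidean_space \<Rightarrow> ereal"
  assumes conv: "convex_fun h" and fin: "\<And>z. \<bar>h z\<bar> \<noteq> \<infinity>"
  shows "convex_on UNIV (\<lambda>z. real_of_ereal (h z))"
proof (rule convex_onI)
  fix t :: real and v w :: 'a
  assume t: "0 < t" "t < 1"
  have real: "ereal (real_of_ereal (h z)) = h z" for z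
    using fin[of z] by (simp add: ereal_real)
  have "(v, real_of_ereal (h v)) \<in> epi h" "(w, real_of_ereal (h w)) \<in> epi h"
    by (simp_all add: epi_def real)
  then have "(1 - t) *\<^sub>R (v, real_of_ereal (h v)) + t *\<^sub>R (w, real_of_ereal (h w)) \<in> epi h"
    using conv t unfolding convex_fun_def by (intro convexD) auto
  then have "h ((1 - t) *\<^sub>R v + t *\<^sub>R w)
      \<le> ereal ((1 - t) * real_of_ereal (h v) + t * real_of_ereal (h w))"
    by (simp add: epi_def)
  then have "ereal (real_of_ereal (h ((1 - t) *\<^sub>R v + t *\<^sub>R w)))
      \<le> ereal ((1 - t) * real_of_ereal (h v) + t * real_of_ereal (h w))"
    by (simp add: real)
  then show "real_of_ereal (h ((1 - t) *\<^sub>R v + t *\<^sub>R w))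
      \<le> (1 - t) * real_of_ereal (h v) + t * real_of_ereal (h w)"
    by simp
qed simp

text \<open>
  Along the segment from \<open>u\<close> to \<open>z\<close> this is the tangent inequality for a convex function of one
  real variable.
\<close>

lemma convex_on_above_gradient:
  fixes p :: "'a::real_inner \<Rightarrow> real"
  assumes conv: "convex_on UNIV p" and grad: "GDERIV p u :> G"
  shows "p u + G \<bullet> (z - u) \<le> p z"
proof -
  let ?q = "\<lambda>t::real. p (u + t *\<^sub>R (z - u))"
  have "convex_on UNIV ?q"
  proof (rule convex_onI)
    fix t a b :: real
    assume t: "0 < t" "t < 1"
    have "u + ((1 - t) *\<^sub>R a + t *\<^sub>R b) *\<^sub>R (z - u)
        = (1 - t) *\<^sub>R (u + a *\<^sub>R (z - u)) + t *\<^sub>R (u + b *\<^sub>R (z - u))"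
      by (simp add: algebra_simps)
    then show "?q ((1 - t) *\<^sub>R a + t *\<^sub>R b) \<le> (1 - t) * ?q a + t * ?q b"
      using convex_onD[OF conv, of t "u + a *\<^sub>R (z - u)" "u + b *\<^sub>R (z - u)"] t by simp
  qed simp
  moreover have "(?q has_real_derivative (G \<bullet> (z - u))) (at 0)"
  proof -
    have "(p has_derivative (\<lambda>v. v \<bullet> G)) (at (u + 0 *\<^sub>R (z - u)))"
      using grad by (simp add: gderiv_def)
    moreover have "((\<lambda>t. u + t *\<^sub>R (z - u)) has_derivative (\<lambda>t. t *\<^sub>R (z - u))) (at 0)"
      by (auto intro!: derivative_eq_intros)
    ultimately have "(?q has_derivative (\<lambda>t. (t *\<^sub>R (z - u)) \<bullet> G)) (at 0)"
      by (rule has_derivative_compose[rotated])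
    then show ?thesis
      by (simp add: has_field_derivative_def inner_commute mult_commute_abs)
  qed
  ultimately have "?q 1 - ?q 0 \<ge> (G \<bullet> (z - u)) * (1 - 0)"
    by (intro convex_on_imp_above_tangent[where A = UNIV]) auto
  then show ?thesis
    by simp
qed

lemma concave_on_below_tangent:
  fixes \<psi> :: "real \<Rightarrow> real"
  assumes conc: "concave_on {0..<r} \<psi>"
    and der: "(\<psi> has_real_derivative D) (at t)"
    and t: "0 < t" "t < r" and s: "0 \<le> s" "s < r"
  shows "\<psi> s \<le> \<psi> t + D * (s - t)"
proof -
  have "t \<in> interior {0..<r}"
    using t by simp
  moreover have "((\<lambda>t. - \<psi> t) has_real_derivative (- D)) (at t within {0..<r})"
    using der by (intro derivative_intros) (rule has_field_derivative_at_within)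
  ultimately have "- \<psi> s - (- \<psi> t) \<ge> - D * (s - t)"
    using conc s t unfolding concave_on_def
    by (intro convex_on_imp_above_tangent[where A = "{0..<r}"]) auto
  then show ?thesis by simp
qed

lemma sqrt_below_tangent:
  assumes "0 < t" "0 \<le> s"
  shows "sqrt s \<le> sqrt t + 1 / (2 * sqrt t) * (s - t)"
proof -
  have st: "0 < sqrt t" "sqrt t * sqrt t = t" "sqrt s * sqrt s = s"
    using assms by auto
  have "0 \<le> (sqrt s - sqrt t)\<^sup>2"
    by simp
  then have "2 * sqrt t * sqrt s \<le> s + t"
    using st by (simp add: power2_eq_square algebra_simps)
  then have "sqrt s \<le> (s + t) / (2 * sqrt t)"
    using st by (simp add: field_simps)
  also have "\<dots> = sqrt t + 1 / (2 * sqrt t) * (s - t)"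
    using st by (simp add: field_simps)
  finally show ?thesis .
qed

section \<open>Desingularisation and finite length\<close>

text \<open>
  The transfer of a desingularising function from \<open>a\<close> to \<open>a + b\<close>, where \<open>a\<close> is an energy gap, \<open>b\<close>
  a quadratic penalty and \<open>s\<close> the length scale that controls both the residual and \<open>b\<close>.  The
  modified function \<open>\<phi> k\<close> is again concave, and its derivative at \<open>a + b\<close> times \<open>C * s\<close> is at
  least \<open>1\<close> by a case distinction: for \<open>b \<le> a\<close> the point \<open>(a + b) / 2\<close> lies below \<open>a\<close>, where
  \<open>\<psi>'\<close> is larger; for \<open>a < b\<close> the value \<open>a + b\<close> is below \<open>2 * \<kappa> * s\<^sup>2\<close>, and the derivative of the
  square root is large enough; \<open>k\<close> is chosen to give exactly \<open>1\<close> there.  Gaps \<open>a \<le> 0\<close> fall under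
  the second case.
\<close>

lemma desingularised_decrease:
  fixes \<psi> \<psi>' :: "real \<Rightarrow> real"
  defines "\<phi> \<equiv> \<lambda>k t. 2 * \<psi> (t / 2) + k * sqrt t"
  assumes conc: "concave_on {0..<r} \<psi>"
    and der: "\<And>t. \<lbrakk>0 < t; t < r\<rbrakk> \<Longrightarrow> (\<psi> has_real_derivative \<psi>' t) (at t)"
    and pos: "\<And>t. \<lbrakk>0 < t; t < r\<rbrakk> \<Longrightarrow> 0 < \<psi>' t"
    and C: "0 < C" and \<kappa>: "0 < \<kappa>" and k: "k = 2 * sqrt (2 * \<kappa>) / C"
    and b: "0 \<le> b" "b \<le> \<kappa> * s\<^sup>2" and s: "0 \<le> s"
    and h: "0 < a + b" "a + b < r" and h': "0 \<le> h'" "h' \<le> a + b"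
    and KL: "0 < a \<Longrightarrow> 1 \<le> \<psi>' a * (C * s)"
  shows "a + b - h' \<le> C * s * (\<phi> k (a + b) - \<phi> k h')"
proof -
  define h where "h = a + b"
  define q where "q = 1 / (2 * sqrt h)"
  define D where "D = \<psi>' (h / 2) + k * q"
  have h0: "0 < h" "h < r"
    using h by (simp_all add: h_def)
  have k0: "0 \<le> k"
    using C \<kappa> by (simp add: k)
  have "\<psi> (h' / 2) \<le> \<psi> (h / 2) + \<psi>' (h / 2) * (h' / 2 - h / 2)"
    using h0 h' by (intro concave_on_below_tangent[OF conc der]) (auto simp: h_def)
  moreover have "k * sqrt h' \<le> k * (sqrt h + q * (h' - h))"
    using sqrt_below_tangent[of h h'] h0 h' k0 unfolding q_def by (intro mult_left_mono) auto
  ultimately have tangent: "D * (h - h') \<le> \<phi> k h - \<phi> k h'"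
    unfolding D_def \<phi>_def by (simp add: algebra_simps)
  have \<psi>'_pos: "0 < \<psi>' (h / 2)"
    using h0 by (intro pos) auto
  \<comment> \<open>\<open>D\<close> is the derivative of \<open>\<phi> k\<close> at \<open>h\<close>.\<close>
  have "1 \<le> D * (C * s)"
  proof (cases "b \<le> a")
    case True
    have a: "0 < a" "a < r" "h / 2 \<le> a"
      using True h b by (auto simp: h_def)
    have "\<psi>' a \<le> \<psi>' (h / 2)"
    proof (cases "h / 2 = a")
      case False
      then have lt: "h / 2 < a"
        using a by simp
      \<comment> \<open>Adding the tangent inequalities at both points shows that \<open>\<psi>'\<close> is nonincreasing.\<close>
      have "\<psi> (h / 2) \<le> \<psi> a + \<psi>' a * (h / 2 - a)" "\<psi> a \<le> \<psi> (h / 2) + \<psi>' (h / 2) * (a - h / 2)"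
        using h0 a by (auto intro!: concave_on_below_tangent[OF conc der])
      then have "\<psi>' a * (a - h / 2) \<le> \<psi>' (h / 2) * (a - h / 2)"
        by (simp add: algebra_simps)
      then show ?thesis
        using lt by (auto dest: mult_right_le_imp_le)
    qed simp
    also have "\<dots> \<le> D"
      using k0 h0 by (simp add: D_def q_def)
    finally have "\<psi>' a * (C * s) \<le> D * (C * s)"
      using C s by (intro mult_right_mono) auto
    then show ?thesis
      using KL a by simp
  next
    case False
    then have "h \<le> 2 * \<kappa> * s\<^sup>2"
      using b by (simp add: h_def)
    then have "sqrt h \<le> sqrt (2 * \<kappa>) * s"
      using s by (metis real_sqrt_abs real_sqrt_le_mono real_sqrt_mult abs_of_nonneg)
    then have "1 \<le> k * q * (C * s)"
      using h0 C by (simp add: k q_def field_simps)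
    also have "\<dots> \<le> D * (C * s)"
      using \<psi>'_pos C s by (intro mult_right_mono) (auto simp: D_def)
    finally show ?thesis .
  qed
  then have "1 * (h - h') \<le> D * (C * s) * (h - h')"
    using h' by (intro mult_right_mono) (auto simp: h_def)
  also have "\<dots> = C * s * (D * (h - h'))"
    by simp
  also have "\<dots> \<le> C * s * (\<phi> k h - \<phi> k h')"
    using tangent C s by (intro mult_left_mono) auto
  finally show ?thesis
    by (simp add: h_def)
qed

text \<open>
  The hypothesis \<open>step\<close> is only available while the sequence stays in a ball, so staying in the
  ball and being summable have to be proved together.  Splitting the product in \<open>step\<close> by the
  arithmetic-geometric mean inequality gives \<open>3 * e (Suc n) \<le> e n + 4 * K * (P (Suc n) - P (Suc (Suc n)))\<close>;
  the \<open>P\<close>-terms telescope, so the path length from time \<open>N\<close> on is controlled by \<open>e N\<close> and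
  \<open>P (Suc N)\<close>.  Both are small when \<open>N\<close> is late, and along the subsequence \<open>x N\<close> is also close to
  \<open>xbar\<close>, so the path cannot leave the ball.
\<close>

lemma local_telescoping_finite_length:
  fixes x :: "nat \<Rightarrow> 'a::real_normed_vector" and P :: "nat \<Rightarrow> real"
  defines "e \<equiv> \<lambda>n. norm (x (Suc n) - x n)"
  assumes P_nonneg: "\<And>n. N0 \<le> n \<Longrightarrow> 0 \<le> P n" and P_lim: "P \<longlonglongrightarrow> 0"
    and e_lim: "e \<longlonglongrightarrow> 0" and moving: "\<And>n. x (Suc n) \<noteq> x n"
    and sub: "strict_mono r" "(x \<circ> r) \<longlonglongrightarrow> xbar" and \<epsilon>: "0 < \<epsilon>" and K: "0 \<le> K"
    and step: "\<And>n. \<lbrakk>N0 \<le> n; x (Suc n) \<in> ball xbar \<epsilon>\<rbrakk> \<Longrightarrow>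
      (e (Suc n))\<^sup>2 \<le> K * (e (Suc n) + e n) * (P (Suc n) - P (Suc (Suc n)))"
  shows "summable e"
proof -
  have e0: "0 < e n" for n
    using moving[of n] by (simp add: e_def)
  have "(\<lambda>n. e n + 4 * K * P (Suc n)) \<longlonglongrightarrow> 0 + 4 * K * 0"
    using P_lim by (intro tendsto_intros e_lim) (rule LIMSEQ_Suc)
  then have small: "\<forall>\<^sub>F n in sequentially. e n + 4 * K * P (Suc n) < \<epsilon>"
    using order_tendstoD(2)[of _ 0 _ \<epsilon>] \<epsilon> by simp
  have "\<forall>\<^sub>F n in sequentially. e n < \<epsilon> / 4"
    using order_tendstoD(2)[OF e_lim, of "\<epsilon> / 4"] \<epsilon> by simp
  with small have "\<forall>\<^sub>F n in sequentially. N0 \<le> n \<and> e n < \<epsilon> / 4 \<and> e n + 4 * K * P (Suc n) < \<epsilon>"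
    using eventually_ge_at_top[of N0] by eventually_elim auto
  then have ev1: "\<forall>\<^sub>F j in sequentially. N0 \<le> r j \<and> e (r j) < \<epsilon> / 4 \<and>
      e (r j) + 4 * K * P (Suc (r j)) < \<epsilon>"
    using sub(1) by (rule eventually_subseq[rotated])
  have "\<forall>\<^sub>F j in sequentially. dist ((x \<circ> r) j) xbar < \<epsilon> / 4"
    using tendstoD[OF sub(2), of "\<epsilon> / 4"] \<epsilon> by simp
  with ev1 have "\<forall>\<^sub>F j in sequentially. N0 \<le> r j \<and> e (r j) < \<epsilon> / 4 \<and>
      e (r j) + 4 * K * P (Suc (r j)) < \<epsilon> \<and> dist (x (r j)) xbar < \<epsilon> / 4"
    by eventually_elim auto
  then obtain N where N: "N0 \<le> N" "e N < \<epsilon> / 4" "e N + 4 * K * P (Suc N) < \<epsilon>"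
      "dist (x N) xbar < \<epsilon> / 4"
    by (auto simp: eventually_sequentially)
  define S where "S m = (\<Sum>i<m. e (Suc N + i))" for m
  have bound: "3 * S m + e (N + m) \<le> S m + e N + 4 * K * (P (Suc N) - P (Suc N + m))
      \<and> norm (x (Suc N + m) - x (Suc N)) \<le> S m \<and> x (Suc N + m) \<in> ball xbar \<epsilon>" for m
  proof (induction m)
    case 0
    have "dist (x (Suc N)) xbar \<le> e N + dist (x N) xbar"
      unfolding e_def using dist_triangle[of "x (Suc N)" xbar "x N"] by (simp add: dist_norm)
    then show ?case
      using N \<epsilon> by (simp add: S_def dist_commute)
  next
    case (Suc m)
    let ?n = "N + m"
    have n: "N0 \<le> ?n" "x (Suc ?n) \<in> ball xbar \<epsilon>"
      using Suc N(1) by auto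
    define A where "A = e (Suc ?n) + e ?n"
    define B where "B = K * (P (Suc ?n) - P (Suc (Suc ?n)))"
    have A: "0 < A"
      using e0[of "Suc ?n"] e0[of ?n] by (simp add: A_def)
    have AB: "(e (Suc ?n))\<^sup>2 \<le> A * B"
      using step[OF n] by (simp add: A_def B_def mult.assoc mult.left_commute)
    \<comment> \<open>As the sequence never pauses, \<open>A\<close> is positive, and the sign of \<open>A * B\<close> passes to \<open>B\<close>.\<close>
    then have "0 \<le> A * B"
      by (rule order_trans[OF zero_le_power2])
    then have B: "0 \<le> B"
      using A by (simp add: zero_le_mult_iff)
    note AB
    also have "A * B \<le> (A / 4 + B)\<^sup>2"
      using zero_le_power2[of "A / 4 - B"] by (simp add: power2_eq_square algebra_simps)
    finally have "e (Suc ?n) \<le> A / 4 + B"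
      using A B by (intro power2_le_imp_le[of "e (Suc ?n)"]) auto
    then have rec: "3 * e (Suc ?n) \<le> e ?n + 4 * B"
      unfolding A_def by argo
    have S: "S (Suc m) = S m + e (Suc ?n)"
      by (simp add: S_def)
    have sum: "3 * S (Suc m) + e (N + Suc m)
        \<le> S (Suc m) + e N + 4 * K * (P (Suc N) - P (Suc N + Suc m))"
      using Suc rec by (simp add: S B_def algebra_simps)
    have "norm (x (Suc N + Suc m) - x (Suc N))
        \<le> norm (x (Suc N + m) - x (Suc N)) + e (Suc ?n)"
      unfolding e_def using norm_triangle_ineq[of "x (Suc N + m) - x (Suc N)" "x (Suc (Suc ?n)) - x (Suc ?n)"]
      by (simp add: algebra_simps)
    then have near: "norm (x (Suc N + Suc m) - x (Suc N)) \<le> S (Suc m)"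
      using Suc by (simp add: S)
    have "0 \<le> 4 * K * P (Suc N + Suc m)"
      using K P_nonneg[of "Suc N + Suc m"] N(1) by simp
    then have "2 * S (Suc m) < \<epsilon>"
      using sum e0[of "N + Suc m"] N(3) by (simp add: algebra_simps)
    moreover have "dist (x (Suc N + Suc m)) xbar
        \<le> dist (x (Suc N + Suc m)) (x (Suc N)) + dist (x (Suc N)) (x N) + dist (x N) xbar"
      using dist_triangle[of "x (Suc N + Suc m)" xbar "x (Suc N)"]
        dist_triangle[of "x (Suc N)" xbar "x N"] by simp
    ultimately have "dist (x (Suc N + Suc m)) xbar < \<epsilon>"
      using near N(2,4) unfolding e_def dist_norm by simp
    then have "x (Suc N + Suc m) \<in> ball xbar \<epsilon>"
      by (simp add: dist_commute)
    with sum near show ?case by blast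
  qed
  have S_le: "S m \<le> \<epsilon>" for m
  proof -
    have "0 \<le> 4 * K * P (Suc N + m)" "0 \<le> S m"
      using K P_nonneg[of "Suc N + m"] N(1) e0 by (auto simp: S_def intro: sum_nonneg less_imp_le)
    then show ?thesis
      using bound[of m] e0[of "N + m"] N(3) by (simp add: algebra_simps)
  qed
  have "(\<Sum>i\<le>m. e (Suc N + i)) \<le> \<epsilon>" for m
    using S_le[of "Suc m"] by (simp only: S_def lessThan_Suc_atMost)
  then have "summable (\<lambda>i. e (Suc N + i))"
    using e0 by (intro bounded_imp_summable[of _ \<epsilon>]) (auto simp: less_imp_le)
  then show ?thesis
    using summable_iff_shift[of e "Suc N"] by (simp add: add.commute)
qed

section \<open>Subgradients and the KL inequality for real-valued functions\<close>

definition is_subgradient :: "('a::real_inner \<Rightarrow> real) \<Rightarrow> 'a \<Rightarrow> 'a \<Rightarrow> bool" where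
  "is_subgradient g z \<zeta> \<longleftrightarrow> (\<forall>w. g z + \<zeta> \<bullet> (w - z) \<le> g w)"

lemma is_subgradientD: "is_subgradient g z \<zeta> \<Longrightarrow> g z + \<zeta> \<bullet> (w - z) \<le> g w"
  by (simp add: is_subgradient_def)

lemma is_subgradient_limit:
  assumes sub: "\<And>n. is_subgradient g (z n) (\<zeta> n)"
    and lim: "z \<longlonglongrightarrow> zbar" "\<zeta> \<longlonglongrightarrow> \<zeta>bar" and cont: "continuous_on UNIV g"
  shows "is_subgradient g zbar \<zeta>bar"
  unfolding is_subgradient_def
proof
  fix w
  have "(\<lambda>n. g (z n)) \<longlonglongrightarrow> g zbar"
    by (rule continuous_on_tendsto_compose[OF cont lim(1)]) auto
  then have "(\<lambda>n. g (z n) + \<zeta> n \<bullet> (w - z n)) \<longlonglongrightarrow> g zbar + \<zeta>bar \<bullet> (w - zbar)"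
    by (intro tendsto_intros lim)
  then show "g zbar + \<zeta>bar \<bullet> (w - zbar) \<le> g w"
    by (rule LIMSEQ_le_const2) (use sub in \<open>auto dest: is_subgradientD\<close>)
qed

text \<open>
  The KL inequality at one point for a real-valued function, with a real radius \<open>r\<close> for the
  values, a ball as neighbourhood, and the distance of \<open>0\<close> from \<open>dF z\<close> replaced by the norm of each
  element of \<open>dF z\<close>.
\<close>

definition real_KL_at ::
  "('a::real_normed_vector \<Rightarrow> real) \<Rightarrow> ('a \<Rightarrow> 'a set) \<Rightarrow> 'a \<Rightarrow> bool" where
  "real_KL_at F dF z0 \<longleftrightarrow> (\<exists>r \<epsilon> \<psi> \<psi>'. 0 < r \<and> 0 < \<epsilon> \<and>
     continuous_on {0..<r} \<psi> \<and> concave_on {0..<r} \<psi> \<and> (\<forall>t\<in>{0..<r}. 0 \<le> \<psi> t) \<and> \<psi> 0 = 0 \<and>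
     (\<forall>t\<in>{0<..<r}. (\<psi> has_real_derivative \<psi>' t) (at t) \<and> 0 < \<psi>' t) \<and>
     (\<forall>z\<in>ball z0 \<epsilon>. \<forall>w\<in>dF z. F z0 < F z \<longrightarrow> F z < F z0 + r \<longrightarrow>
        1 \<le> \<psi>' (F z - F z0) * norm w))"

text \<open>
  Any positive real below the given range of values and any ball inside the given neighbourhood
  serve, and the infimum in \<open>dist0\<close> is at most the norm of each element.
\<close>

lemma real_KL_at_if_KL_function:
  assumes "KL_function h dh" and "0 \<in> dh z0" and h: "\<And>z. h z = ereal (F z)"
  shows "real_KL_at F dh z0"
proof -
  have "\<exists>(\<nu>::ereal) U (\<psi>::real \<Rightarrow> real) \<psi>'.
          0 < \<nu> \<and> open U \<and> z0 \<in> U \<and>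
          continuous_on {t. 0 \<le> t \<and> ereal t < \<nu>} \<psi> \<and>
          concave_on {t. 0 \<le> t \<and> ereal t < \<nu>} \<psi> \<and>
          (\<forall>t. 0 \<le> t \<and> ereal t < \<nu> \<longrightarrow> 0 \<le> \<psi> t) \<and>
          \<psi> 0 = 0 \<and>
          (\<forall>t. 0 < t \<and> ereal t < \<nu> \<longrightarrow> (\<psi> has_real_derivative \<psi>' t) (at t) \<and> 0 < \<psi>' t) \<and>
          continuous_on {t. 0 < t \<and> ereal t < \<nu>} \<psi>' \<and>
          (\<forall>x\<in>U. h z0 < h x \<and> h x < h z0 + \<nu> \<longrightarrow>
             1 \<le> ereal (\<psi>' (real_of_ereal (h x - h z0))) * dist0 (dh x))"
    using assms(1,2) unfolding KL_function_def by (elim conjE allE impE)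
  then show ?thesis
  proof (elim exE conjE)
    fix \<nu> :: ereal and U and \<psi> \<psi>' :: "real \<Rightarrow> real"
    assume \<nu>: "0 < \<nu>" and U: "open U" "z0 \<in> U"
      and cont: "continuous_on {t. 0 \<le> t \<and> ereal t < \<nu>} \<psi>"
      and conc: "concave_on {t. 0 \<le> t \<and> ereal t < \<nu>} \<psi>"
      and nonneg: "\<forall>t. 0 \<le> t \<and> ereal t < \<nu> \<longrightarrow> 0 \<le> \<psi> t" and \<psi>_0: "\<psi> 0 = 0"
      and der: "\<forall>t. 0 < t \<and> ereal t < \<nu> \<longrightarrow> (\<psi> has_real_derivative \<psi>' t) (at t) \<and> 0 < \<psi>' t"
      and ineq: "\<forall>x\<in>U. h z0 < h x \<and> h x < h z0 + \<nu> \<longrightarrow>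
             1 \<le> ereal (\<psi>' (real_of_ereal (h x - h z0))) * dist0 (dh x)"
    obtain r where r: "0 < r" "ereal r < \<nu>"
      using ereal_dense2[OF \<nu>] by auto
    have lt: "ereal t < \<nu>" if "t < r" for t
      using less_trans[of "ereal t" "ereal r" \<nu>] that r(2) by simp
    then have sub: "{0..<r} \<subseteq> {t. 0 \<le> t \<and> ereal t < \<nu>}"
      by auto
    obtain \<epsilon> where \<epsilon>: "0 < \<epsilon>" "ball z0 \<epsilon> \<subseteq> U"
      using U by (auto simp: open_contains_ball)
    have KL: "1 \<le> \<psi>' (F z - F z0) * norm w"
      if z: "z \<in> ball z0 \<epsilon>" and w: "w \<in> dh z" and less: "F z0 < F z" "F z < F z0 + r" for z w
    proof -
      define t where "t = F z - F z0"
      have t: "0 < t" "ereal t < \<nu>"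
        using less lt[of t] by (simp_all add: t_def)
      have "ereal (F z) < ereal (F z0) + \<nu>"
        using t(2) by (cases \<nu>) (auto simp: t_def)
      then have "1 \<le> ereal (\<psi>' t) * dist0 (dh z)"
        using bspec[OF ineq, of z] z \<epsilon>(2) less(1) by (auto simp: h t_def)
      also have "\<dots> \<le> ereal (\<psi>' t) * ereal (norm w)"
      proof (rule ereal_mult_left_mono)
        show "dist0 (dh z) \<le> ereal (norm w)"
          unfolding dist0_def using w by (rule INF_lower)
        show "0 \<le> ereal (\<psi>' t)"
          using der t by (simp add: less_imp_le)
      qed
      finally show ?thesis
        by (simp add: t_def)
    qed
    show ?thesis
      unfolding real_KL_at_def
    proof (intro exI conjI)
      show "continuous_on {0..<r} \<psi>"
        using cont sub by (rule continuous_on_subset)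
      show "concave_on {0..<r} \<psi>"
        using conc sub unfolding concave_on_def by (rule convex_on_subset) simp
      show "\<forall>t\<in>{0..<r}. 0 \<le> \<psi> t"
        using nonneg lt by simp
      show "\<forall>t\<in>{0<..<r}. (\<psi> has_real_derivative \<psi>' t) (at t) \<and> 0 < \<psi>' t"
        using der lt by simp
      show "\<forall>z\<in>ball z0 \<epsilon>. \<forall>w\<in>dh z. F z0 < F z \<longrightarrow> F z < F z0 + r \<longrightarrow>
          1 \<le> \<psi>' (F z - F z0) * norm w"
        using KL by blast
    qed (fact r(1) \<epsilon>(1) \<psi>_0)+
  qed
qed

section \<open>Extrapolated proximal steps with line search\<close>

text \<open>
  The features of the algorithm that drive its convergence, for \<open>E = p - g\<close> with \<open>p\<close> smooth and
  convex.  The proximal subproblem enters through its optimality condition \<open>optimal\<close>, and the line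
  search through \<open>unit_or_rejected\<close>: an accepted step below \<open>1\<close> means that the unit step violated the
  sufficient decrease condition.  The difference \<open>x n - x (n - 1)\<close> vanishes at \<open>n = 0\<close> by truncated
  subtraction.  The initial step parameter \<open>\<alpha> 0\<close> is arbitrary, which is why the bounds by \<open>\<alpha>min\<close> and
  \<open>\<alpha>max\<close>, and the estimates that rely on them, start at index \<open>1\<close>.
\<close>

locale extrapolated_dc_run =
  fixes p g :: "'a::euclidean_space \<Rightarrow> real" and Gp :: "'a \<Rightarrow> 'a"
    and M \<alpha>min \<alpha>max \<eta> c0 :: real
    and x \<xi> u :: "nat \<Rightarrow> 'a" and \<alpha> \<beta> l :: "nat \<Rightarrow> real"
  assumes p_convex: "convex_on UNIV p"
    and p_grad: "\<And>z. GDERIV p z :> Gp z"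
    and p_lip: "M-lipschitz_on UNIV Gp"
    and \<alpha>min_pos: "0 < \<alpha>min" and c0_pos: "0 < c0" and \<alpha>max_pos: "0 < \<alpha>max"
    and \<eta>_less: "\<eta> < 1 / \<alpha>max"
    and \<alpha>_0: "0 < \<alpha> 0" and \<alpha>_Suc: "\<And>n. \<alpha>min \<le> \<alpha> (Suc n)" "\<And>n. \<alpha> (Suc n) \<le> \<alpha>max"
    and \<beta>_0: "\<beta> 0 = 0" and \<beta>_bounds: "\<And>n. 0 \<le> \<beta> n" "\<And>n. \<beta> n \<le> 1"
    and \<beta>_Suc: "\<And>n. \<beta> (Suc n) \<noteq> 0 \<Longrightarrow>
      \<beta> (Suc n) \<le> \<alpha> (Suc n) / (\<alpha> n * l n) * (2 - \<beta> n) - 2 * c0 * \<alpha> (Suc n)"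
    and l_bounds: "\<And>n. 0 < l n" "\<And>n. l n \<le> 1"
    and \<xi>_sub: "\<And>n. is_subgradient g (x n) (\<xi> n)"
    and optimal: "\<And>n. Gp (u n) = \<xi> n - (u n - (x n + \<beta> n *\<^sub>R (x n - x (n - 1)))) /\<^sub>R \<alpha> n"
    and moving: "\<And>n. u n \<noteq> x n"
    and x_Suc: "\<And>n. x (Suc n) = x n + l n *\<^sub>R (u n - x n)"
    and unit_or_rejected: "\<And>n. l n = 1 \<or>
      p (x n) - g (x n) - \<eta> * (norm (u n - x n))\<^sup>2 < p (u n) - g (u n)"
begin

definition E :: "'a \<Rightarrow> real" where "E z = p z - g z"

definition d :: "nat \<Rightarrow> 'a" where "d n = u n - x n"

definition \<Delta> :: "nat \<Rightarrow> 'a" where "\<Delta> n = x n - x (n - 1)"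

definition b :: "nat \<Rightarrow> real" where "b n = \<beta> n / (2 * \<alpha> n) * (norm (\<Delta> n))\<^sup>2"

definition H :: "nat \<Rightarrow> real" where "H n = E (x n) + b n"

lemma \<alpha>_pos: "0 < \<alpha> n"
  using \<alpha>_0 \<alpha>_Suc(1)[of "n - 1"] \<alpha>min_pos by (cases n) auto

lemma \<alpha>_le: "\<alpha> n \<le> max \<alpha>max (\<alpha> 0)"
  using \<alpha>_Suc(2)[of "n - 1"] by (cases n) auto

lemma \<Delta>_Suc: "\<Delta> (Suc n) = l n *\<^sub>R d n"
  by (simp add: \<Delta>_def d_def x_Suc)

lemma \<Delta>_Suc_nonzero: "\<Delta> (Suc n) \<noteq> 0"
  using moving[of n] l_bounds(1)[of n] by (simp add: \<Delta>_Suc d_def)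

text \<open>
  On the segment from \<open>x n\<close> to \<open>u n\<close> the convex part \<open>p\<close> lies below its chord, \<open>g\<close> lies above the
  affine function given by \<open>\<xi> n\<close>, and the slope of the chord is at most \<open>Gp (u n) \<bullet> d n\<close>, which the
  optimality condition evaluates.
\<close>

lemma decrease_along_direction:
  assumes t: "0 \<le> t" "t \<le> 1"
  shows "E (x n + t *\<^sub>R d n) \<le> E (x n) - t / \<alpha> n * (norm (d n))\<^sup>2 + t * \<beta> n / \<alpha> n * (d n \<bullet> \<Delta> n)"
proof -
  have grad: "p (u n) - p (x n) \<le> Gp (u n) \<bullet> d n"
    using convex_on_above_gradient[OF p_convex p_grad, of "u n" "x n"]
    by (simp add: d_def inner_diff_right)
  have "x n + t *\<^sub>R d n = (1 - t) *\<^sub>R x n + t *\<^sub>R u n"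
    by (simp add: d_def algebra_simps)
  then have "p (x n + t *\<^sub>R d n) \<le> (1 - t) * p (x n) + t * p (u n)"
    using convex_onD[OF p_convex, of t "x n" "u n"] t by simp
  also have "\<dots> = p (x n) + t * (p (u n) - p (x n))"
    by (simp add: algebra_simps)
  also have "\<dots> \<le> p (x n) + t * (Gp (u n) \<bullet> d n)"
    using grad t by (simp add: mult_left_mono)
  finally have p_le: "p (x n + t *\<^sub>R d n) \<le> p (x n) + t * (Gp (u n) \<bullet> d n)" .
  have g_ge: "g (x n) + t * (\<xi> n \<bullet> d n) \<le> g (x n + t *\<^sub>R d n)"
    using is_subgradientD[OF \<xi>_sub, of n "x n + t *\<^sub>R d n"] by simp
  have Gp_u: "Gp (u n) = \<xi> n - inverse (\<alpha> n) *\<^sub>R d n + (\<beta> n / \<alpha> n) *\<^sub>R \<Delta> n"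
    by (simp add: optimal d_def \<Delta>_def algebra_simps divide_inverse)
  have "Gp (u n) \<bullet> d n = \<xi> n \<bullet> d n - inverse (\<alpha> n) * (norm (d n))\<^sup>2 + \<beta> n / \<alpha> n * (d n \<bullet> \<Delta> n)"
    unfolding Gp_u power2_norm_eq_inner
    by (simp add: inner_add_left inner_diff_left inner_commute[of "\<Delta> n" "d n"])
  then have t_Gp_u: "t * (Gp (u n) \<bullet> d n) = t * (\<xi> n \<bullet> d n) - t / \<alpha> n * (norm (d n))\<^sup>2
      + t * \<beta> n / \<alpha> n * (d n \<bullet> \<Delta> n)"
    by (simp add: distrib_left right_diff_distrib divide_inverse mult.assoc)
  show ?thesis
    using p_le g_ge t_Gp_u by (simp add: E_def)
qed

definition c1 :: real where "c1 = min c0 (1 / (2 * max \<alpha>max (\<alpha> 0)))"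

lemma c1_pos: "0 < c1"
  using c0_pos \<alpha>max_pos by (simp add: c1_def max_def)

text \<open>
  This is where the bound on \<open>\<beta> (Suc n)\<close> is used.  If \<open>\<beta> (Suc n)\<close> is positive, the bound says
  precisely that the gap is at least \<open>c0\<close>; if it is \<open>0\<close>, the right-hand side alone is bounded below
  because \<open>\<beta> n\<close> and \<open>l n\<close> are at most \<open>1\<close>.
\<close>

lemma weight_gap: "\<beta> (Suc n) / (2 * \<alpha> (Suc n)) + c1 \<le> (2 - \<beta> n) / (2 * \<alpha> n * l n)"
proof (cases "\<beta> (Suc n) = 0")
  case True
  have "\<alpha> n * l n \<le> max \<alpha>max (\<alpha> 0) * 1"
    using \<alpha>_le[of n] \<alpha>_pos[of n] l_bounds[of n] by (intro mult_mono) auto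
  then have "1 / (2 * max \<alpha>max (\<alpha> 0)) \<le> (2 - \<beta> n) / (2 * \<alpha> n * l n)"
    using \<alpha>_pos[of n] l_bounds[of n] \<beta>_bounds[of n] by (intro frac_le) auto
  then show ?thesis
    using True by (simp add: c1_def)
next
  case False
  have "\<beta> (Suc n) / (2 * \<alpha> (Suc n))
      \<le> (\<alpha> (Suc n) / (\<alpha> n * l n) * (2 - \<beta> n) - 2 * c0 * \<alpha> (Suc n)) / (2 * \<alpha> (Suc n))"
    using \<beta>_Suc[OF False] \<alpha>_pos[of "Suc n"] by (intro divide_right_mono) auto
  also have "\<dots> = (2 - \<beta> n) / (2 * \<alpha> n * l n) - c0"
    using \<alpha>_pos[of n] \<alpha>_pos[of "Suc n"] l_bounds(1)[of n] by (simp add: field_simps)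
  finally show ?thesis
    by (simp add: c1_def)
qed

text \<open>
  Young's inequality splits the extrapolation term into halves.  One half is the penalty \<open>b n\<close>;
  the other is charged to \<open>\<Delta> (Suc n)\<close>, and \<open>weight_gap\<close> shows that what is left of the decrease
  covers \<open>b (Suc n)\<close> with the margin \<open>c1\<close>.
\<close>

lemma H_decrease: "H (Suc n) + c1 * (norm (\<Delta> (Suc n)))\<^sup>2 \<le> H n"
proof -
  define N where "N = (norm (\<Delta> (Suc n)))\<^sup>2"
  have pos: "0 < \<alpha> n" "0 < l n"
    using \<alpha>_pos l_bounds by auto
  have N: "0 \<le> N" "N = (l n)\<^sup>2 * (norm (d n))\<^sup>2"
    by (simp_all add: N_def \<Delta>_Suc power_mult_distrib)
  have "E (x (Suc n)) \<le> E (x n) - l n / \<alpha> n * (norm (d n))\<^sup>2 + l n * \<beta> n / \<alpha> n * (d n \<bullet> \<Delta> n)"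
    using decrease_along_direction[of "l n" n] l_bounds[of n] by (simp add: x_Suc d_def)
  also have "l n / \<alpha> n * (norm (d n))\<^sup>2 = N / (\<alpha> n * l n)"
    using pos by (simp add: N power2_eq_square field_simps)
  also have "l n * \<beta> n / \<alpha> n * (d n \<bullet> \<Delta> n) = \<beta> n / \<alpha> n * (\<Delta> (Suc n) \<bullet> \<Delta> n)"
    by (simp add: \<Delta>_Suc)
  finally have 1: "E (x (Suc n)) \<le> E (x n) - N / (\<alpha> n * l n) + \<beta> n / \<alpha> n * (\<Delta> (Suc n) \<bullet> \<Delta> n)" .
  have "\<Delta> (Suc n) \<bullet> \<Delta> n \<le> (N + (norm (\<Delta> n))\<^sup>2) / 2"
    using inner_ge_zero[of "\<Delta> (Suc n) - \<Delta> n"]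
    by (simp add: N_def power2_norm_eq_inner inner_diff_left inner_diff_right inner_commute)
  then have "\<beta> n / \<alpha> n * (\<Delta> (Suc n) \<bullet> \<Delta> n) \<le> \<beta> n / \<alpha> n * ((N + (norm (\<Delta> n))\<^sup>2) / 2)"
    using pos \<beta>_bounds[of n] by (intro mult_left_mono) auto
  also have "\<dots> = \<beta> n / (2 * \<alpha> n) * N + b n"
    using pos by (simp add: b_def field_simps)
  finally have 2: "\<beta> n / \<alpha> n * (\<Delta> (Suc n) \<bullet> \<Delta> n) \<le> \<beta> n / (2 * \<alpha> n) * N + b n" .
  have "\<beta> n / (2 * \<alpha> n) \<le> \<beta> n / (2 * \<alpha> n * l n)"
    using pos \<beta>_bounds[of n] l_bounds[of n] by (intro divide_left_mono) (auto simp: mult_le_cancel_left1)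
  moreover have "(2 - \<beta> n) / (2 * \<alpha> n * l n) = 1 / (\<alpha> n * l n) - \<beta> n / (2 * \<alpha> n * l n)"
    using pos by (simp add: field_simps)
  ultimately have "\<beta> (Suc n) / (2 * \<alpha> (Suc n)) + c1 \<le> 1 / (\<alpha> n * l n) - \<beta> n / (2 * \<alpha> n)"
    using weight_gap[of n] by linarith
  then have "(\<beta> (Suc n) / (2 * \<alpha> (Suc n)) + c1) * N \<le> (1 / (\<alpha> n * l n) - \<beta> n / (2 * \<alpha> n)) * N"
    using N(1) by (rule mult_right_mono)
  then have "b (Suc n) + c1 * N \<le> N / (\<alpha> n * l n) - \<beta> n / (2 * \<alpha> n) * N"
    by (simp add: b_def N_def algebra_simps)
  then show ?thesis
    using 1 2 by (simp add: H_def N_def)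
qed

text \<open>
  The line search may accept tiny steps, so \<open>\<Delta> (Suc n) = l n *\<^sub>R d n\<close> does not control \<open>d n\<close>.  But
  rejection of the unit step contradicts the decrease \<open>(1 / \<alpha> n - \<eta>) * (norm (d n))\<^sup>2\<close> unless the
  extrapolation term, of size \<open>norm (d n) * norm (\<Delta> n)\<close>, is at least as large; the condition
  \<open>\<eta> < 1 / \<alpha>max\<close> makes this a bound of \<open>d n\<close> by \<open>\<Delta> n\<close>.
\<close>

lemma direction_bound:
  obtains K where "0 \<le> K"
    "\<And>n. norm (d (Suc n)) \<le> norm (\<Delta> (Suc (Suc n))) + K * norm (\<Delta> (Suc n))"
proof
  let ?K = "1 / \<alpha>min / (1 / \<alpha>max - \<eta>)"
  show K: "0 \<le> ?K"
    using \<alpha>min_pos \<eta>_less by simp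
  fix n
  let ?n = "Suc n"
  show "norm (d ?n) \<le> norm (\<Delta> (Suc ?n)) + ?K * norm (\<Delta> ?n)"
  proof (cases "l ?n = 1")
    case True
    then show ?thesis
      using K by (simp add: \<Delta>_Suc[of ?n])
  next
    case False
    have d0: "0 < norm (d ?n)"
      using moving[of ?n] by (simp add: d_def)
    have "E (x ?n) - \<eta> * (norm (d ?n))\<^sup>2 < E (u ?n)"
      using unit_or_rejected[of ?n] False by (simp add: E_def d_def)
    also have "\<dots> \<le> E (x ?n) - 1 / \<alpha> ?n * (norm (d ?n))\<^sup>2 + \<beta> ?n / \<alpha> ?n * (d ?n \<bullet> \<Delta> ?n)"
      using decrease_along_direction[of 1 ?n] by (simp add: d_def)
    finally have "(1 / \<alpha> ?n - \<eta>) * (norm (d ?n))\<^sup>2 \<le> \<beta> ?n / \<alpha> ?n * (d ?n \<bullet> \<Delta> ?n)"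
      by (simp add: algebra_simps)
    moreover have "(1 / \<alpha>max - \<eta>) * (norm (d ?n))\<^sup>2 \<le> (1 / \<alpha> ?n - \<eta>) * (norm (d ?n))\<^sup>2"
      using \<alpha>_Suc(2)[of n] \<alpha>_pos[of ?n] by (intro mult_right_mono) (auto simp: frac_le)
    moreover have "\<beta> ?n / \<alpha> ?n * (d ?n \<bullet> \<Delta> ?n) \<le> 1 / \<alpha>min * (norm (d ?n) * norm (\<Delta> ?n))"
    proof -
      have "\<beta> ?n / \<alpha> ?n * (d ?n \<bullet> \<Delta> ?n) \<le> \<beta> ?n / \<alpha> ?n * (norm (d ?n) * norm (\<Delta> ?n))"
        using \<beta>_bounds[of ?n] \<alpha>_pos[of ?n] by (intro mult_left_mono norm_cauchy_schwarz) auto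
      also have "\<dots> \<le> 1 / \<alpha>min * (norm (d ?n) * norm (\<Delta> ?n))"
        using \<beta>_bounds[of ?n] \<alpha>_Suc(1)[of n] \<alpha>min_pos by (intro mult_right_mono frac_le) auto
      finally show ?thesis .
    qed
    ultimately have "norm (d ?n) * ((1 / \<alpha>max - \<eta>) * norm (d ?n))
        \<le> norm (d ?n) * (1 / \<alpha>min * norm (\<Delta> ?n))"
      by (simp add: power2_eq_square algebra_simps)
    then have "(1 / \<alpha>max - \<eta>) * norm (d ?n) \<le> 1 / \<alpha>min * norm (\<Delta> ?n)"
      using d0 by (rule mult_left_le_imp_le)
    then have "norm (d ?n) \<le> (1 / \<alpha>min * norm (\<Delta> ?n)) / (1 / \<alpha>max - \<eta>)"
      using \<eta>_less by (intro mult_imp_le_div_pos) (auto simp: mult.commute)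
    then have "norm (d ?n) \<le> ?K * norm (\<Delta> ?n)"
      by (simp only: times_divide_eq_left)
    then show ?thesis
      using norm_ge_zero[of "\<Delta> (Suc ?n)"] by linarith
  qed
qed

text \<open>
  Subtracting the optimality condition at \<open>u n\<close> leaves a gradient difference, controlled by
  \<open>norm (d n)\<close>, and the proximal term, controlled by \<open>norm (d n)\<close> and \<open>norm (\<Delta> n)\<close>.
\<close>

lemma residual_bound:
  obtains C where "0 < C"
    "\<And>n. norm (Gp (x (Suc n)) - \<xi> (Suc n)) \<le> C * (norm (\<Delta> (Suc (Suc n))) + norm (\<Delta> (Suc n)))"
proof -
  obtain K where K: "0 \<le> K"
    "\<And>n. norm (d (Suc n)) \<le> norm (\<Delta> (Suc (Suc n))) + K * norm (\<Delta> (Suc n))"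
    using direction_bound by blast
  have M: "0 \<le> M"
    using p_lip by (rule lipschitz_on_nonneg)
  define B where "B = M + 1 / \<alpha>min"
  have B: "0 < B" "1 / \<alpha>min \<le> B"
    using M \<alpha>min_pos by (simp_all add: B_def add_nonneg_pos)
  show ?thesis
  proof
    show "0 < B * (K + 1)"
      using B K by simp
    fix n
    let ?n = "Suc n"
    define w where "w = d ?n - \<beta> ?n *\<^sub>R \<Delta> ?n"
    have "Gp (u ?n) = \<xi> ?n - w /\<^sub>R \<alpha> ?n"
      using optimal[of ?n] by (simp only: w_def d_def \<Delta>_def algebra_simps)
    then have "Gp (x ?n) - \<xi> ?n = (Gp (x ?n) - Gp (u ?n)) - w /\<^sub>R \<alpha> ?n"
      by simp
    then have "norm (Gp (x ?n) - \<xi> ?n) \<le> norm (Gp (x ?n) - Gp (u ?n)) + norm (w /\<^sub>R \<alpha> ?n)"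
      by (metis norm_triangle_ineq4)
    moreover have "norm (Gp (x ?n) - Gp (u ?n)) \<le> M * norm (d ?n)"
      using lipschitz_onD[OF p_lip, of "x ?n" "u ?n"]
      by (simp add: dist_norm d_def norm_minus_commute)
    moreover have "norm (w /\<^sub>R \<alpha> ?n) \<le> 1 / \<alpha>min * (norm (d ?n) + norm (\<Delta> ?n))"
    proof -
      have "norm w \<le> norm (d ?n) + \<beta> ?n * norm (\<Delta> ?n)"
        unfolding w_def using norm_triangle_ineq4[of "d ?n" "\<beta> ?n *\<^sub>R \<Delta> ?n"] \<beta>_bounds[of ?n] by simp
      also have "\<dots> \<le> norm (d ?n) + 1 * norm (\<Delta> ?n)"
        using \<beta>_bounds[of ?n] by (intro add_left_mono mult_right_mono) auto
      finally have "norm w / \<alpha> ?n \<le> (norm (d ?n) + norm (\<Delta> ?n)) / \<alpha>min"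
        using \<alpha>_Suc(1)[of n] \<alpha>min_pos by (intro frac_le) auto
      then show ?thesis
        using \<alpha>_pos[of ?n] by (simp add: divide_inverse mult.commute)
    qed
    ultimately have "norm (Gp (x ?n) - \<xi> ?n) \<le> B * norm (d ?n) + 1 / \<alpha>min * norm (\<Delta> ?n)"
      by (simp add: B_def algebra_simps)
    also have "\<dots> \<le> B * (norm (\<Delta> (Suc ?n)) + K * norm (\<Delta> ?n)) + B * norm (\<Delta> ?n)"
      using B K(2)[of n] by (intro add_mono mult_left_mono mult_right_mono) auto
    also have "\<dots> \<le> B * (K + 1) * (norm (\<Delta> (Suc ?n)) + norm (\<Delta> ?n))"
      using B(1) K(1) by (simp add: algebra_simps)
    finally show "norm (Gp (x ?n) - \<xi> ?n) \<le> B * (K + 1) * (norm (\<Delta> (Suc ?n)) + norm (\<Delta> ?n))" .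
  qed
qed

lemma b_bounds: "0 \<le> b n" "b (Suc n) \<le> 1 / (2 * \<alpha>min) * (norm (\<Delta> (Suc n)))\<^sup>2"
proof -
  show "0 \<le> b n"
    using \<beta>_bounds[of n] \<alpha>_pos[of n] by (simp add: b_def)
  show "b (Suc n) \<le> 1 / (2 * \<alpha>min) * (norm (\<Delta> (Suc n)))\<^sup>2"
    unfolding b_def using \<beta>_bounds[of "Suc n"] \<alpha>_Suc(1)[of n] \<alpha>min_pos
    by (intro mult_right_mono frac_le) auto
qed

lemma H_less: "H (Suc n) < H n"
proof -
  have "0 < c1 * (norm (\<Delta> (Suc n)))\<^sup>2"
    using c1_pos \<Delta>_Suc_nonzero[of n] by simp
  then show ?thesis
    using H_decrease[of n] by linarith
qed

lemma decseq_H: "decseq H"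
  by (intro decseq_SucI less_imp_le H_less)

lemma E_le_initial: "E (x n) \<le> E (x 0)"
proof -
  have "E (x n) \<le> H n" using b_bounds(1)[of n] by (simp add: H_def)
  also have "\<dots> \<le> H 0" using decseq_H by (simp add: decseq_def)
  also have "\<dots> = E (x 0)" by (simp add: H_def b_def \<beta>_0)
  finally show ?thesis .
qed

lemma E_continuous:
  assumes "continuous_on UNIV g"
  shows "continuous_on UNIV E"
proof -
  have "continuous_on UNIV p"
    using p_convex by (intro convex_on_continuous) auto
  with assms show ?thesis
    unfolding E_def[abs_def] by (intro continuous_intros)
qed

lemma steps_vanish:
  assumes "\<And>z. m \<le> E z"
  obtains Hs where "H \<longlonglongrightarrow> Hs" "\<And>n. Hs < H n" "(\<lambda>n. norm (\<Delta> (Suc n))) \<longlonglongrightarrow> 0"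
    "(\<lambda>n. E (x n)) \<longlonglongrightarrow> Hs"
proof -
  have "m \<le> H n" for n
    using assms[of "x n"] b_bounds(1)[of n] by (simp add: H_def)
  then obtain Hs where Hs: "H \<longlonglongrightarrow> Hs" "\<And>n. Hs \<le> H n"
    using decseq_convergent[OF decseq_H, of m] by auto
  have less: "Hs < H n" for n
    using Hs(2)[of "Suc n"] H_less[of n] by linarith
  have "(\<lambda>n. (H n - H (Suc n)) / c1) \<longlonglongrightarrow> (Hs - Hs) / c1"
    using c1_pos by (intro tendsto_intros Hs(1) LIMSEQ_Suc) auto
  then have *: "(\<lambda>n. (H n - H (Suc n)) / c1) \<longlonglongrightarrow> 0"
    by simp
  have sq: "(\<lambda>n. (norm (\<Delta> (Suc n)))\<^sup>2) \<longlonglongrightarrow> 0"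
  proof (rule tendsto_sandwich[OF _ _ tendsto_const *])
    show "\<forall>\<^sub>F n in sequentially. (norm (\<Delta> (Suc n)))\<^sup>2 \<le> (H n - H (Suc n)) / c1"
      using H_decrease c1_pos by (auto simp: pos_le_divide_eq algebra_simps)
  qed simp
  have steps: "(\<lambda>n. norm (\<Delta> (Suc n))) \<longlonglongrightarrow> 0"
    using tendsto_real_sqrt[OF sq] by simp
  have "(\<lambda>n. 1 / (2 * \<alpha>min) * (norm (\<Delta> (Suc n)))\<^sup>2) \<longlonglongrightarrow> 1 / (2 * \<alpha>min) * 0"
    by (intro tendsto_intros sq)
  then have **: "(\<lambda>n. 1 / (2 * \<alpha>min) * (norm (\<Delta> (Suc n)))\<^sup>2) \<longlonglongrightarrow> 0"
    by simp
  have "(\<lambda>n. b (Suc n)) \<longlonglongrightarrow> 0"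
    by (rule tendsto_sandwich[OF _ _ tendsto_const **]) (use b_bounds in auto)
  then have "b \<longlonglongrightarrow> 0"
    by (rule LIMSEQ_imp_Suc)
  then have "(\<lambda>n. H n - b n) \<longlonglongrightarrow> Hs - 0"
    by (intro tendsto_diff Hs(1))
  then have "(\<lambda>n. E (x n)) \<longlonglongrightarrow> Hs"
    by (simp add: H_def)
  with Hs(1) less steps show ?thesis
    using that by blast
qed

text \<open>
  The residuals tend to \<open>0\<close>, so along the subsequence the subgradients \<open>\<xi>\<close> converge to the gradient
  of \<open>p\<close> at the cluster point, and the graph of the subdifferential of \<open>g\<close> is closed.
\<close>

lemma cluster_point_critical:
  assumes g_cont: "continuous_on UNIV g"
    and steps: "(\<lambda>n. norm (\<Delta> (Suc n))) \<longlonglongrightarrow> 0"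
    and sub: "strict_mono r" "(x \<circ> r) \<longlonglongrightarrow> xbar"
  shows "is_subgradient g xbar (Gp xbar)"
proof -
  obtain C where C: "0 < C"
    "\<And>n. norm (Gp (x (Suc n)) - \<xi> (Suc n)) \<le> C * (norm (\<Delta> (Suc (Suc n))) + norm (\<Delta> (Suc n)))"
    using residual_bound by blast
  have "(\<lambda>n. C * (norm (\<Delta> (Suc (Suc n))) + norm (\<Delta> (Suc n)))) \<longlonglongrightarrow> C * (0 + 0)"
    by (intro tendsto_intros steps LIMSEQ_Suc[OF steps])
  then have "(\<lambda>n. C * (norm (\<Delta> (Suc (Suc n))) + norm (\<Delta> (Suc n)))) \<longlonglongrightarrow> 0"
    by simp
  then have "(\<lambda>n. Gp (x (Suc n)) - \<xi> (Suc n)) \<longlonglongrightarrow> 0"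
    by (rule Lim_null_comparison[rotated]) (use C(2) in auto)
  then have "(\<lambda>n. Gp (x n) - \<xi> n) \<longlonglongrightarrow> 0"
    by (rule LIMSEQ_imp_Suc)
  then have res: "(\<lambda>j. Gp (x (r j)) - \<xi> (r j)) \<longlonglongrightarrow> 0"
    using LIMSEQ_subseq_LIMSEQ[OF _ sub(1)] by (simp add: o_def)
  have "(\<lambda>j. Gp (x (r j))) \<longlonglongrightarrow> Gp xbar"
    using sub(2) by (intro continuous_on_tendsto_compose[OF lipschitz_on_continuous_on[OF p_lip]])
      (auto simp: o_def)
  from tendsto_diff[OF this res] have "(\<lambda>j. \<xi> (r j)) \<longlonglongrightarrow> Gp xbar"
    by simp
  moreover have "(\<lambda>j. x (r j)) \<longlonglongrightarrow> xbar"
    using sub(2) by (simp add: o_def)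
  ultimately show ?thesis
    using is_subgradient_limit[of g "\<lambda>j. x (r j)" "\<lambda>j. \<xi> (r j)", OF \<xi>_sub] g_cont by blast
qed

text \<open>
  At a cluster point \<open>xbar\<close> the energy equals the limit \<open>Hs\<close> of \<open>H\<close>, so the KL inequality there
  speaks about the gaps \<open>E (x n) - Hs\<close>.  \<open>desingularised_decrease\<close> turns it into a recursion for the
  decreasing gaps \<open>H n - Hs\<close>, and \<open>local_telescoping_finite_length\<close> yields finite length; a
  sequence of finite length converges, necessarily to \<open>xbar\<close>.
\<close>

lemma converges_to_critical_point:
  assumes g_cont: "continuous_on UNIV g"
    and below: "\<And>z. m \<le> E z"
    and level: "compact {z. E z \<le> E (x 0)}"
    and KL: "\<And>z. is_subgradient g z (Gp z) \<Longrightarrow>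
      real_KL_at E (\<lambda>z. {Gp z - \<zeta> |\<zeta>. is_subgradient g z \<zeta>}) z"
  shows "\<exists>xstar. x \<longlonglongrightarrow> xstar \<and> is_subgradient g xstar (Gp xstar) \<and>
    summable (\<lambda>n. norm (x (Suc n) - x n))"
proof -
  obtain Hs where Hs: "H \<longlonglongrightarrow> Hs" "\<And>n. Hs < H n"
    and steps: "(\<lambda>n. norm (\<Delta> (Suc n))) \<longlonglongrightarrow> 0" and E_lim: "(\<lambda>n. E (x n)) \<longlonglongrightarrow> Hs"
    using steps_vanish[OF below] by blast
  obtain xbar r where sub: "strict_mono r" "(x \<circ> r) \<longlonglongrightarrow> xbar"
    using level E_le_initial unfolding compact_def by (metis mem_Collect_eq)
  have crit: "is_subgradient g xbar (Gp xbar)"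
    using g_cont steps sub by (rule cluster_point_critical)
  have "(\<lambda>j. E ((x \<circ> r) j)) \<longlonglongrightarrow> E xbar"
    by (rule continuous_on_tendsto_compose[OF E_continuous[OF g_cont] sub(2)]) auto
  moreover have "(\<lambda>j. E ((x \<circ> r) j)) \<longlonglongrightarrow> Hs"
    using LIMSEQ_subseq_LIMSEQ[OF E_lim sub(1)] by (simp add: o_def)
  ultimately have Exbar: "E xbar = Hs"
    by (rule LIMSEQ_unique)
  have "\<exists>r \<epsilon> \<psi> \<psi>'. 0 < r \<and> 0 < \<epsilon> \<and>
      continuous_on {0..<r} \<psi> \<and> concave_on {0..<r} \<psi> \<and> (\<forall>t\<in>{0..<r}. 0 \<le> \<psi> t) \<and> \<psi> 0 = 0 \<and>
      (\<forall>t\<in>{0<..<r}. (\<psi> has_real_derivative \<psi>' t) (at t) \<and> 0 < \<psi>' t) \<and>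
      (\<forall>z\<in>ball xbar \<epsilon>. \<forall>w\<in>{Gp z - \<zeta> |\<zeta>. is_subgradient g z \<zeta>}. Hs < E z \<longrightarrow> E z < Hs + r \<longrightarrow>
        1 \<le> \<psi>' (E z - Hs) * norm w)"
    using KL[OF crit] unfolding real_KL_at_def Exbar .
  then have length: "summable (\<lambda>n. norm (x (Suc n) - x n))"
  proof (elim exE conjE)
    fix R \<epsilon> :: real and \<psi> \<psi>' :: "real \<Rightarrow> real"
    assume R: "0 < R" and \<epsilon>: "0 < \<epsilon>"
      and \<psi>_cont: "continuous_on {0..<R} \<psi>" and conc: "concave_on {0..<R} \<psi>"
      and \<psi>_nonneg: "\<forall>t\<in>{0..<R}. 0 \<le> \<psi> t" and \<psi>_0: "\<psi> 0 = 0"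
      and \<psi>': "\<forall>t\<in>{0<..<R}. (\<psi> has_real_derivative \<psi>' t) (at t) \<and> 0 < \<psi>' t"
      and ineq: "\<forall>z\<in>ball xbar \<epsilon>. \<forall>w\<in>{Gp z - \<zeta> |\<zeta>. is_subgradient g z \<zeta>}.
        Hs < E z \<longrightarrow> E z < Hs + R \<longrightarrow> 1 \<le> \<psi>' (E z - Hs) * norm w"
    have der: "(\<psi> has_real_derivative \<psi>' t) (at t)" and pos: "0 < \<psi>' t" if "0 < t" "t < R" for t
      using \<psi>' that by auto
    obtain C where C: "0 < C"
      "\<And>n. norm (Gp (x (Suc n)) - \<xi> (Suc n)) \<le> C * (norm (\<Delta> (Suc (Suc n))) + norm (\<Delta> (Suc n)))"
      using residual_bound by blast
    define h where "h n = H n - Hs" for n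
    define k where "k = 2 * sqrt (2 * (1 / (2 * \<alpha>min))) / C"
    define P where "P n = 2 * \<psi> (h n / 2) + k * sqrt (h n)" for n
    have h_pos: "0 < h n" for n
      using Hs(2)[of n] by (simp add: h_def)
    have "(\<lambda>n. H n - Hs) \<longlonglongrightarrow> Hs - Hs"
      by (intro tendsto_intros Hs(1))
    then have h_lim: "h \<longlonglongrightarrow> 0"
      by (simp add: h_def[abs_def])
    have "\<forall>\<^sub>F n in sequentially. h n < R"
      using order_tendstoD(2)[OF h_lim R] .
    then obtain N0 where N0: "\<And>n. N0 \<le> n \<Longrightarrow> h n < R"
      by (auto simp: eventually_sequentially)
    have k0: "0 \<le> k"
      using C(1) \<alpha>min_pos by (simp add: k_def)
    show "summable (\<lambda>n. norm (x (Suc n) - x n))"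
    proof (rule local_telescoping_finite_length[where P = P and ?N0.0 = N0 and K = "C / c1"])
      show "0 \<le> P n" if "N0 \<le> n" for n
        using bspec[OF \<psi>_nonneg, of "h n / 2"] N0[OF that] h_pos[of n] k0 by (simp add: P_def)
      have "(\<lambda>n. \<psi> (h n / 2)) \<longlonglongrightarrow> \<psi> 0"
      proof (rule continuous_on_tendsto_compose[OF \<psi>_cont])
        show "(\<lambda>n. h n / 2) \<longlonglongrightarrow> 0"
          using tendsto_divide[OF h_lim tendsto_const, of 2] by simp
        show "\<forall>\<^sub>F n in sequentially. h n / 2 \<in> {0..<R}"
          using \<open>\<forall>\<^sub>F n in sequentially. h n < R\<close>
        proof eventually_elim
          case (elim n)
          then show ?case using h_pos[of n] by simp
        qed
      qed (use R in simp)
      then have "P \<longlonglongrightarrow> 2 * \<psi> 0 + k * sqrt 0"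
        unfolding P_def[abs_def] by (intro tendsto_intros h_lim)
      then show "P \<longlonglongrightarrow> 0"
        by (simp add: \<psi>_0)
      show "(\<lambda>n. norm (x (Suc n) - x n)) \<longlonglongrightarrow> 0"
        using steps by (simp add: \<Delta>_def)
      show "x (Suc n) \<noteq> x n" for n
        using \<Delta>_Suc_nonzero[of n] by (simp add: \<Delta>_def)
      show "0 \<le> C / c1"
        using C(1) c1_pos by simp
      show "(norm (x (Suc (Suc n)) - x (Suc n)))\<^sup>2
          \<le> C / c1 * (norm (x (Suc (Suc n)) - x (Suc n)) + norm (x (Suc n) - x n))
            * (P (Suc n) - P (Suc (Suc n)))"
        if n: "N0 \<le> n" and near: "x (Suc n) \<in> ball xbar \<epsilon>" for n
      proof -
        define s where "s = norm (\<Delta> (Suc (Suc n))) + norm (\<Delta> (Suc n))"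
        define a where "a = E (x (Suc n)) - Hs"
        have ab: "a + b (Suc n) = h (Suc n)"
          by (simp add: a_def h_def H_def)
        have hR: "h (Suc n) < R"
          using N0[of "Suc n"] n by simp
        have "b (Suc n) \<le> 1 / (2 * \<alpha>min) * s\<^sup>2"
        proof -
          have "(norm (\<Delta> (Suc n)))\<^sup>2 \<le> s\<^sup>2"
            by (intro power_mono) (auto simp: s_def)
          then have "1 / (2 * \<alpha>min) * (norm (\<Delta> (Suc n)))\<^sup>2 \<le> 1 / (2 * \<alpha>min) * s\<^sup>2"
            using \<alpha>min_pos by (intro mult_left_mono) auto
          then show ?thesis
            using b_bounds(2)[of n] by linarith
        qed
        moreover have "1 \<le> \<psi>' a * (C * s)" if "0 < a"
        proof -
          have aR: "a < R"
            using ab hR b_bounds(1)[of "Suc n"] by linarith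
          have "1 \<le> \<psi>' a * norm (Gp (x (Suc n)) - \<xi> (Suc n))"
            using ineq near \<xi>_sub[of "Suc n"] that aR by (auto simp: a_def)
          also have "\<dots> \<le> \<psi>' a * (C * s)"
            using C(2)[of n] pos[OF that aR] by (intro mult_left_mono) (auto simp: s_def)
          finally show ?thesis .
        qed
        ultimately have "h (Suc n) - h (Suc (Suc n)) \<le> C * s * (P (Suc n) - P (Suc (Suc n)))"
          using desingularised_decrease[OF conc der pos, where b = "b (Suc n)" and s = s and a = a
              and h' = "h (Suc (Suc n))" and \<kappa> = "1 / (2 * \<alpha>min)" and k = k and C = C]
            C(1) b_bounds(1)[of "Suc n"] \<alpha>min_pos h_pos[of "Suc n"] h_pos[of "Suc (Suc n)"] hR
            H_less[of "Suc n"]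
          unfolding ab P_def by (simp add: s_def h_def k_def)
        moreover have "c1 * (norm (\<Delta> (Suc (Suc n))))\<^sup>2 \<le> h (Suc n) - h (Suc (Suc n))"
          using H_decrease[of "Suc n"] by (simp add: h_def)
        ultimately have "c1 * (norm (\<Delta> (Suc (Suc n))))\<^sup>2 \<le> C * s * (P (Suc n) - P (Suc (Suc n)))"
          by linarith
        then have "(norm (\<Delta> (Suc (Suc n))))\<^sup>2 \<le> C / c1 * s * (P (Suc n) - P (Suc (Suc n)))"
          using c1_pos by (simp add: field_simps)
        then show ?thesis
          by (simp add: s_def \<Delta>_def)
      qed
    qed (use sub \<epsilon> in auto)
  qed
  then have "summable (\<lambda>n. x (Suc n) - x n)"
    by (rule summable_norm_cancel)
  then have "(\<lambda>n. (\<Sum>i<n. x (Suc i) - x i) + x 0) \<longlonglongrightarrow> (\<Sum>n. x (Suc n) - x n) + x 0"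
    by (intro tendsto_add summable_LIMSEQ tendsto_const)
  then have "convergent x"
    by (auto simp: sum_lessThan_telescope convergent_def)
  then obtain xstar where "x \<longlonglongrightarrow> xstar"
    by (auto simp: convergent_def)
  moreover have "xstar = xbar"
    using LIMSEQ_subseq_LIMSEQ[OF \<open>x \<longlonglongrightarrow> xstar\<close> sub(1)] sub(2) by (rule LIMSEQ_unique)
  ultimately show ?thesis
    using crit length by blast
qed

end

section \<open>Convergence of the algorithm\<close>

lemma gradient_of_minimiser:
  fixes p :: "'a::real_inner \<Rightarrow> real"
  assumes grad: "GDERIV p v :> G" and a: "0 < a"
    and min: "\<And>z. - \<xi> \<bullet> (v - y) + 1 / (2 * a) * (norm (v - y))\<^sup>2 + p v
      \<le> - \<xi> \<bullet> (z - y) + 1 / (2 * a) * (norm (z - y))\<^sup>2 + p z"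
  shows "G = \<xi> - (v - y) /\<^sub>R a"
proof -
  let ?q = "\<lambda>z. - \<xi> \<bullet> (z - y) + 1 / (2 * a) * ((z - y) \<bullet> (z - y)) + p z"
  have "(?q has_derivative (\<lambda>w. - \<xi> \<bullet> w + 1 / (2 * a) * (2 * ((v - y) \<bullet> w)) + w \<bullet> G)) (at v)"
    using grad a unfolding gderiv_def
    by (auto intro!: derivative_eq_intros simp: inner_commute)
  moreover have "\<forall>z\<in>UNIV. ?q v \<le> ?q z"
    using min by (simp add: power2_norm_eq_inner)
  ultimately have zero: "(\<lambda>w. - \<xi> \<bullet> w + 1 / (2 * a) * (2 * ((v - y) \<bullet> w)) + w \<bullet> G) = (\<lambda>w. 0)"
    by (intro differential_zero_maxmin[where S = UNIV and f = ?q]) auto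
  have "(- \<xi> + (v - y) /\<^sub>R a + G) \<bullet> w = 0" for w
  proof -
    have "- \<xi> \<bullet> w + ((v - y) \<bullet> w) / a + G \<bullet> w = 0"
      using fun_cong[OF zero, of w] a by (simp only: inner_commute[of w G]) simp
    then show ?thesis
      by (simp only: inner_add_left inner_scaleR_left divide_inverse mult.commute)
  qed
  from this[of "- \<xi> + (v - y) /\<^sub>R a + G"] have "- \<xi> + (v - y) /\<^sub>R a + G = 0"
    by simp
  then show ?thesis
    by (simp add: algebra_simps add_eq_0_iff)
qed

lemma bb_step_bounds:
  assumes "\<alpha>min \<le> \<alpha>max"
  shows "\<alpha>min \<le> bb_step \<alpha>min \<alpha>max n s w" "bb_step \<alpha>min \<alpha>max n s w \<le> \<alpha>max"
  using assms by (auto simp: bb_step_def)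

theorem theorem6:
  fixes f :: "'a::euclidean_space \<Rightarrow> real"
    and g1 g2 :: "'a \<Rightarrow> ereal"
    and Gf Gg1 :: "'a \<Rightarrow> 'a"
    and L Lg1 \<alpha>min \<alpha>max \<rho> \<beta>bar \<omega> \<eta> c0 :: real
    and x y \<xi> u :: "nat \<Rightarrow> 'a"
    and \<alpha> \<beta> l :: "nat \<Rightarrow> real"
  assumes f_convex: "convex_on UNIV f"
    and f_grad: "\<And>z. GDERIV f z :> Gf z"
    and f_lip: "L-lipschitz_on UNIV Gf"
    and g1_pcc: "proper_fun g1" "closed_fun g1" "convex_fun g1"
    and g2_pcc: "proper_fun g2" "closed_fun g2" "convex_fun g2"
    and E_below: "\<exists>m::real. \<forall>z. ereal m \<le> dc_fun f g1 g2 z"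
    and E_levels: "\<And>a::real. compact {z. dc_fun f g1 g2 z \<le> ereal a}"
    and g1_finite: "\<And>z. \<bar>g1 z\<bar> \<noteq> \<infinity>"
    and g1_grad: "\<And>z. GDERIV (\<lambda>w. real_of_ereal (g1 w)) z :> Gg1 z"
    and g1_lip: "Lg1-lipschitz_on UNIV Gg1"
    and E_KL: "KL_function (dc_fun f g1 g2) (dc_subdiff Gf Gg1 g2)"
    and run: "pABBDCA_se f Gf g1 g2 \<alpha>min \<alpha>max \<rho> \<beta>bar \<omega> \<eta> c0 x y \<xi> u \<alpha> \<beta> l"
  shows "\<exists>xstar. x \<longlonglongrightarrow> xstar \<and> 0 \<in> dc_subdiff Gf Gg1 g2 xstar \<and>
           summable (\<lambda>n. norm (x (n + 1) - x n))"
proof -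
  define g1r where "g1r z = real_of_ereal (g1 z)" for z
  define g where "g z = real_of_ereal (g2 z)" for z
  define p where "p z = f z + g1r z" for z
  define Gp where "Gp z = Gf z + Gg1 z" for z
  have g1_eq: "g1 z = ereal (g1r z)" for z
    using g1_finite[of z] by (simp add: g1r_def ereal_real)
  obtain m where m: "\<And>z. ereal m \<le> dc_fun f g1 g2 z"
    using E_below by blast
  have g2_finite: "\<bar>g2 z\<bar> \<noteq> \<infinity>" for z
  proof -
    \<comment> \<open>A value \<open>\<infinity>\<close> of \<open>g2\<close> would make the objective \<open>-\<infinity>\<close> there.\<close>
    have "g2 z \<noteq> - \<infinity>"
      using g2_pcc(1) by (simp add: proper_fun_def)
    moreover have "g2 z \<noteq> \<infinity>"
      using m[of z] by (auto simp: dc_fun_def g1_eq)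
    ultimately show ?thesis by auto
  qed
  then have g2_eq: "g2 z = ereal (g z)" for z
    by (simp add: g_def ereal_real)
  have E_eq: "dc_fun f g1 g2 z = ereal (p z - g z)" for z
    by (simp add: dc_fun_def g1_eq g2_eq p_def)
  have subdiff_eq: "\<zeta> \<in> subdiff g2 z \<longleftrightarrow> is_subgradient g z \<zeta>" for z \<zeta>
    by (simp add: subdiff_def is_subgradient_def g2_eq)
  have g_cont: "continuous_on UNIV g"
    unfolding g_def[abs_def]
    by (intro convex_on_continuous convex_on_real_of_ereal g2_pcc(3) g2_finite) auto
  have p_convex: "convex_on UNIV p"
    unfolding p_def[abs_def] g1r_def
    by (intro convex_on_add f_convex convex_on_real_of_ereal g1_pcc(3) g1_finite)
  have p_grad: "GDERIV p z :> Gp z" for z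
    unfolding p_def[abs_def] g1r_def Gp_def by (intro GDERIV_add f_grad g1_grad)
  have p_lip: "(L + Lg1)-lipschitz_on UNIV Gp"
    unfolding Gp_def[abs_def] by (intro lipschitz_on_add f_lip g1_lip)

  note run_unfolded = run[unfolded pABBDCA_se_def]
  then have params: "0 < \<alpha>min" "\<alpha>min < \<alpha>max" "0 < \<alpha> 0" "0 < \<rho>" "\<rho> < 1" "\<beta>bar < 1" "0 < \<omega>"
      "\<eta> < 1 / \<alpha>max" "0 < c0" "\<beta> 0 = 0"
    by - (elim conjE, assumption)+
  have "\<forall>n\<ge>1. \<beta> n =
        max 0 (min (min ((real n - 1) / (real n + 2)) \<beta>bar)
                   (\<alpha> n / (\<alpha> (n - 1) * l (n - 1)) * (2 - \<beta> (n - 1)) - 2 * c0 * \<alpha> n))"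
    using run_unfolded by (elim conjE)
  note \<beta>_rec = this[rule_format]
  have iter: "\<forall>n.
        y n = x n + \<beta> n *\<^sub>R (x n - x (n - 1)) \<and>
        \<xi> n \<in> subdiff g2 (x n) \<and>
        is_arg_min
          (\<lambda>z. ereal (- \<xi> n \<bullet> (z - y n) + 1 / (2 * \<alpha> n) * (norm (z - y n))\<^sup>2 + f z) + g1 z)
          (\<lambda>z. True) (u n) \<and>
        u n - x n \<noteq> 0 \<and>
        (\<exists>k::nat. l n = \<rho> ^ k \<and>
           linesearch_ok (dc_fun f g1 g2) \<eta> \<omega> n (x n) (u n - x n) (\<rho> ^ k) \<and>
           (\<forall>j<k. \<not> linesearch_ok (dc_fun f g1 g2) \<eta> \<omega> n (x n) (u n - x n) (\<rho> ^ j))) \<and>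
        x (Suc n) = x n + l n *\<^sub>R (u n - x n) \<and>
        \<alpha> (Suc n) = bb_step \<alpha>min \<alpha>max n (x (Suc n) - y n) (Gf (x (Suc n)) - Gf (y n))"
    using run_unfolded by (elim conjE)
  note y = iter[THEN spec, THEN conjunct1]
  note iter = iter[THEN spec, THEN conjunct2]
  note \<xi> = iter[THEN conjunct1]
  note iter = iter[THEN conjunct2]
  note u = iter[THEN conjunct1]
  note iter = iter[THEN conjunct2]
  note moving = iter[THEN conjunct1]
  note iter = iter[THEN conjunct2]
  note search = iter[THEN conjunct1]
  note iter = iter[THEN conjunct2]
  note x_Suc = iter[THEN conjunct1]
  note \<alpha>_rec = iter[THEN conjunct2]

  have \<alpha>_Suc: "\<alpha>min \<le> \<alpha> (Suc n)" "\<alpha> (Suc n) \<le> \<alpha>max" for n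
    unfolding \<alpha>_rec using params(2) by (simp_all add: bb_step_bounds)
  have \<alpha>_pos: "0 < \<alpha> n" for n
    using params(1,3) \<alpha>_Suc(1)[of "n - 1"] by (cases n) auto

  interpret run: extrapolated_dc_run p g Gp "L + Lg1" \<alpha>min \<alpha>max \<eta> c0 x \<xi> u \<alpha> \<beta> l
  proof
    show "convex_on UNIV p" "\<And>z. GDERIV p z :> Gp z" "(L + Lg1)-lipschitz_on UNIV Gp"
      by (fact p_convex p_grad p_lip)+
    show "0 < \<alpha>min" "0 < c0" "0 < \<alpha>max" "\<eta> < 1 / \<alpha>max" "0 < \<alpha> 0" "\<beta> 0 = 0"
      using params by auto
    show "\<alpha>min \<le> \<alpha> (Suc n)" "\<alpha> (Suc n) \<le> \<alpha>max" for n
      by (fact \<alpha>_Suc)+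
    show "0 \<le> \<beta> n" for n
      using params(10) \<beta>_rec[of n] by (cases n) auto
    show "\<beta> n \<le> 1" for n
      using params(6,10) \<beta>_rec[of n] by (cases n) (auto simp: max_def min_def)
    show "\<beta> (Suc n) \<le> \<alpha> (Suc n) / (\<alpha> n * l n) * (2 - \<beta> n) - 2 * c0 * \<alpha> (Suc n)"
      if "\<beta> (Suc n) \<noteq> 0" for n
      using that \<beta>_rec[of "Suc n"] by (auto simp: max_def split: if_splits)
    show "0 < l n" "l n \<le> 1" for n
      using search[of n] params(4,5) by (auto simp: power_le_one)
    show "is_subgradient g (x n) (\<xi> n)" for n
      using \<xi>[of n] by (simp add: subdiff_eq)
    show "Gp (u n) = \<xi> n - (u n - (x n + \<beta> n *\<^sub>R (x n - x (n - 1)))) /\<^sub>R \<alpha> n" for n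
      unfolding y[symmetric]
    proof (rule gradient_of_minimiser[OF p_grad \<alpha>_pos])
      show "- \<xi> n \<bullet> (u n - y n) + 1 / (2 * \<alpha> n) * (norm (u n - y n))\<^sup>2 + p (u n)
        \<le> - \<xi> n \<bullet> (z - y n) + 1 / (2 * \<alpha> n) * (norm (z - y n))\<^sup>2 + p z" for z
        using u[of n] unfolding is_arg_min_def by (auto simp: g1_eq p_def not_less add.assoc)
    qed
    show "u n \<noteq> x n" for n
      using moving[of n] by simp
    show "x (Suc n) = x n + l n *\<^sub>R (u n - x n)" for n
      by (fact x_Suc)
    show "l n = 1 \<or> p (x n) - g (x n) - \<eta> * (norm (u n - x n))\<^sup>2 < p (u n) - g (u n)" for n
    proof -
      obtain k where k: "l n = \<rho> ^ k"
        "\<forall>j<k. \<not> linesearch_ok (dc_fun f g1 g2) \<eta> \<omega> n (x n) (u n - x n) (\<rho> ^ j)"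
        using search by blast
      show ?thesis
      proof (cases "k = 0")
        \<comment> \<open>The trial with exponent \<open>0\<close>, the unit step, failed.\<close>
        case False
        then have "\<not> linesearch_ok (dc_fun f g1 g2) \<eta> \<omega> n (x n) (u n - x n) 1"
          using k(2) by (metis neq0_conv power_0)
        then have "p (x n) - g (x n) - \<eta> * (norm (u n - x n))\<^sup>2
            + \<omega> / (real n + 1) * (norm (u n - x n))\<^sup>2 < p (u n) - g (u n)"
          by (simp add: linesearch_ok_def E_eq not_le)
        moreover have "0 \<le> \<omega> / (real n + 1) * (norm (u n - x n))\<^sup>2"
          using params(7) by simp
        ultimately show ?thesis by linarith
      qed (use k in simp)
    qed
  qed

  have "\<exists>xstar. x \<longlonglongrightarrow> xstar \<and> is_subgradient g xstar (Gp xstar) \<and>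
      summable (\<lambda>n. norm (x (Suc n) - x n))"
  proof (rule run.converges_to_critical_point[OF g_cont])
    show "m \<le> run.E z" for z
      using m[of z] by (simp add: E_eq run.E_def)
    show "compact {z. run.E z \<le> run.E (x 0)}"
      using E_levels[of "run.E (x 0)"] by (simp add: E_eq run.E_def)
    fix z0
    assume "is_subgradient g z0 (Gp z0)"
    then have "0 \<in> dc_subdiff Gf Gg1 g2 z0"
      by (auto simp: dc_subdiff_def subdiff_eq Gp_def)
    then have "real_KL_at (\<lambda>z. p z - g z) (dc_subdiff Gf Gg1 g2) z0"
      using E_eq by (rule real_KL_at_if_KL_function[OF E_KL])
    then show "real_KL_at run.E (\<lambda>z. {Gp z - \<zeta> |\<zeta>. is_subgradient g z \<zeta>}) z0"
      by (simp add: run.E_def[abs_def] dc_subdiff_def[abs_def] subdiff_eq Gp_def)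
  qed
  then show ?thesis
    by (auto simp: dc_subdiff_def subdiff_eq Gp_def)
qed

end
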